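(* Let $\mathbb{F}$ be an arbitrary field and let $P(\lambda)=\sum_{k=0}^dP_k\lambda^k\in\mathbb{F}[\lambda]^{n\times n}$ be a regular matrix polynomial of odd degree $d$, with $s=(d-1)/2\geq 1$. Let $\mathcal{L}(\lambda)$ be a strong linearization of $P(\lambda)$ obtained from a block Kronecker pencil, i.e. $$\mathcal{L}(\lambda)=\begin{bmatrix}\lambda B+A & L_s(\lambda)^T\otimes I_n\\ \sigma L_s(\lambda)\otimes I_n & 0\end{bmatrix},\qquad\sigma\in\{1,-1\},$$ where $\lambda B+A$ is an $(s+1)n\times(s+1)n$ pencil over $\mathbb{F}$ with $(\Lambda_s(\lambda)^T\otimes I_n)(\lambda B+A)(\Lambda_s(\lambda)\otimes I_n)=P(\lambda)$. Then: (a) If $z\in\mathbb{F}^{nd\times1}$ is a right eigenvector of $\mathcal{L}(\lambda)$ with finite eigenvalue $\lambda_0$, then the $(s+1)$th block of $z$ is a right eigenvector of $P(\lambda)$ with finite eigenvalue $\lambda_0$. (b) If $z\in\mathbb{F}^{nd\times1}$ is a right eigenvector of $\mathcal{L}(\lambda)$ for the eigenvalue $\infty$, then the first block of $z$ is a right eigenvector of $P(\lambda)$ for the eigenvalue $\infty$.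
   Context: For $k\ge 1$, $L_k(\lambda)\in\mathbb{F}[\lambda]^{k\times(k+1)}$ is the matrix with $-1$ in the $(i,i)$ entries, $\lambda$ in the $(i,i+1)$ entries ($i=1,\dots,k$), and zeros elsewhere; $\Lambda_k(\lambda)^T=\begin{bmatrix}\lambda^k&\cdots&\lambda&1\end{bmatrix}$. A square matrix polynomial is regular if its determinant is not identically zero. Column vectors of size $nd$ are partitioned into $d$ consecutive blocks of size $n$. A right eigenvector of a regular matrix polynomial $R(\lambda)$ with finite eigenvalue $\lambda_0\in\overline{\mathbb{F}}$ is a nonzero vector $x$ with $R(\lambda_0)x=0$; a right eigenvector of $R(\lambda)$ of degree $g$ for the eigenvalue $\infty$ is a nonzero vector $x$ with $(\mathrm{rev}_gR)(0)x=0$, where $\mathrm{rev}_gR(\lambda)=\lambda^gR(\lambda^{-1})$ (i.e. the leading coefficient annihilates $x$). *)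

theory Defs
  imports
    "HOL-Algebra.Algebraic_Closure_Type"
    "Jordan_Normal_Form.Determinant"
begin

text \<open>A matrix polynomial over \<open>'a\<close> is an element of \<^typ>\<open>'a poly mat\<close>, that is, a matrix whose
  entries are polynomials.\<close>

definition coeff_mat :: "'a::zero poly mat \<Rightarrow> nat \<Rightarrow> 'a mat" where
  "coeff_mat R k = map_mat (\<lambda>p. coeff p k) R"

definition has_degree :: "'a::zero poly mat \<Rightarrow> nat \<Rightarrow> bool" where
  "has_degree R d \<longleftrightarrow>
     coeff_mat R d \<noteq> 0\<^sub>m (dim_row R) (dim_col R) \<and>
     (\<forall>k>d. coeff_mat R k = 0\<^sub>m (dim_row R) (dim_col R))"

definition regular :: "'a::field poly mat \<Rightarrow> bool" where
  "regular R \<longleftrightarrow> square_mat R \<and> det R \<noteq> 0"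

definition linear_pencil :: "'a::field mat \<Rightarrow> 'a mat \<Rightarrow> 'a poly mat" where
  "linear_pencil B A = [:0, 1:] \<cdot>\<^sub>m map_mat (\<lambda>c. [:c:]) B + map_mat (\<lambda>c. [:c:]) A"

definition kronecker :: "'a::semiring_0 mat \<Rightarrow> 'a mat \<Rightarrow> 'a mat" (infixl \<open>\<otimes>\<^sub>K\<close> 72) where
  "A \<otimes>\<^sub>K B = mat (dim_row A * dim_row B) (dim_col A * dim_col B)
     (\<lambda>(i, j). A $$ (i div dim_row B, j div dim_col B) * B $$ (i mod dim_row B, j mod dim_col B))"

text \<open>Matrix indices start at 0 here.\<close>

definition L_mat :: "nat \<Rightarrow> 'a::field poly mat" where
  "L_mat k = mat k (k + 1) (\<lambda>(i, j). if j = i then -1 else if j = i + 1 then [:0, 1:] else 0)"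

definition Lambda_col :: "nat \<Rightarrow> 'a::field poly mat" where
  "Lambda_col k = mat (k + 1) 1 (\<lambda>(i, _). monom 1 (k - i))"

text \<open>With \<open>A\<close> and \<open>B\<close> of size \<open>(s+1)n \<times> (s+1)n\<close>, this is a strong linearization of
  \<open>(\<Lambda>\<^sub>s(\<lambda>)\<^sup>T \<otimes> I\<^sub>n)(\<lambda>B + A)(\<Lambda>\<^sub>s(\<lambda>) \<otimes> I\<^sub>n)\<close>, seen as a matrix polynomial of grade \<open>2s+1\<close>, for every
  choice of \<open>A\<close> and \<open>B\<close>.\<close>

definition block_kronecker_pencil ::
    "nat \<Rightarrow> nat \<Rightarrow> 'a::field \<Rightarrow> 'a mat \<Rightarrow> 'a mat \<Rightarrow> 'a poly mat" where
  "block_kronecker_pencil n s \<sigma> B A =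
     four_block_mat
       (linear_pencil B A)                        (transpose_mat (L_mat s) \<otimes>\<^sub>K 1\<^sub>m n)
       ([:\<sigma>:] \<cdot>\<^sub>m (L_mat s \<otimes>\<^sub>K 1\<^sub>m n))            (0\<^sub>m (s * n) (s * n))"

text \<open>Blocks of size \<open>n\<close> of a column vector, numbered from 1.\<close>

definition block :: "nat \<Rightarrow> nat \<Rightarrow> 'a vec \<Rightarrow> 'a vec" where
  "block n i z = vec n (\<lambda>j. z $ ((i - 1) * n + j))"

text \<open>\<open>eval_ac R a\<close> is \<open>R(a)\<close> for a point \<open>a\<close> of the algebraic closure of the coefficient field.\<close>

definition eval_ac :: "'a::field poly mat \<Rightarrow> 'a alg_closure \<Rightarrow> 'a alg_closure mat" where
  "eval_ac R a = map_mat (\<lambda>p. poly (map_poly to_ac p) a) R"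

definition right_eigenvector ::
    "'a::field poly mat \<Rightarrow> 'a alg_closure \<Rightarrow> 'a alg_closure vec \<Rightarrow> bool" where
  "right_eigenvector R a x \<longleftrightarrow>
     x \<in> carrier_vec (dim_col R) \<and> x \<noteq> 0\<^sub>v (dim_col R) \<and> eval_ac R a *\<^sub>v x = 0\<^sub>v (dim_row R)"

text \<open>\<open>rev\<^sub>g p(\<lambda>) = \<lambda>\<^sup>g p(\<lambda>\<^sup>-\<^sup>1)\<close>, for \<open>g\<close> at least the degree of \<open>p\<close>. In contrast to the library
  function \<^const>\<open>reflect_poly\<close>, the reversal is taken with respect to \<open>g\<close> and not to the
  degree of \<open>p\<close>.\<close>

definition rev_poly :: "nat \<Rightarrow> 'a::field poly \<Rightarrow> 'a poly" where
  "rev_poly g p = (\<Sum>k\<le>g. monom (coeff p k) (g - k))"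

lemma poly_rev_poly:
  assumes "degree p \<le> g" and "a \<noteq> 0"
  shows "poly (rev_poly g p) a = a ^ g * poly p (inverse a)"
proof -
  have "poly p (inverse a) = (\<Sum>k\<le>g. coeff p k * inverse a ^ k)"
    unfolding poly_altdef using assms(1)
    by (intro sum.mono_neutral_left) (auto simp: coeff_eq_0)
  moreover have "a ^ (g - k) = a ^ g * inverse a ^ k" if "k \<le> g" for k
    using that assms(2) by (simp add: power_diff power_inverse divide_inverse)
  ultimately show ?thesis
    by (simp add: rev_poly_def poly_sum poly_monom sum_distrib_left mult.left_commute)
qed

definition rev_mat_poly :: "nat \<Rightarrow> 'a::field poly mat \<Rightarrow> 'a poly mat" where
  "rev_mat_poly g R = map_mat (rev_poly g) R"

definition right_eigenvector_inf ::
    "nat \<Rightarrow> 'a::field poly mat \<Rightarrow> 'a alg_closure vec \<Rightarrow> bool" where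
  "right_eigenvector_inf g R x \<longleftrightarrow> right_eigenvector (rev_mat_poly g R) 0 x"

end

theory Submission
  imports Defs
begin

text \<open>Write \<open>z = (x, y)\<close> with \<open>x\<close> consisting of the first \<open>s + 1\<close> blocks. The lower block row of
  \<open>\<L>(\<mu>) z = 0\<close> says \<open>(L\<^sub>s(\<mu>) \<otimes> I) x = 0\<close>, so \<open>x = (\<Lambda>\<^sub>s(\<mu>) \<otimes> I) w\<close> with \<open>w\<close> the last block of \<open>x\<close>.
  Multiplying the upper block row by \<open>\<Lambda>\<^sub>s(\<mu>)\<^sup>T \<otimes> I\<close> kills \<open>y\<close>, since \<open>L\<^sub>s \<Lambda>\<^sub>s = 0\<close>, and leaves
  \<open>P(\<mu>) w = 0\<close>. If \<open>w = 0\<close> then \<open>x = 0\<close>, hence \<open>(L\<^sub>s(\<mu>)\<^sup>T \<otimes> I) y = 0\<close> and \<open>y = 0\<close>.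
  Replacing \<open>\<mu>\<close> by homogeneous coordinates \<open>(a, b)\<close>, the same argument at \<open>(1, 0)\<close> instead of \<open>(\<mu>, 1)\<close>
  settles the eigenvalue \<open>\<infinity>\<close>; there \<open>w\<close> is the first block and \<open>P(\<mu>)\<close> becomes the leading
  coefficient of \<open>P\<close>.\<close>

no_notation fps_nth (infixl \<open>$\<close> 75)

text \<open>Taking the \<open>p\<close>-th entry of each block of size \<open>n\<close> turns the action of \<open>C \<otimes>\<^sub>K 1\<^sub>m n\<close> into that
  of \<open>C\<close>, which avoids the mixed-product rule for Kronecker products.\<close>

definition slice :: "nat \<Rightarrow> nat \<Rightarrow> nat \<Rightarrow> 'a vec \<Rightarrow> 'a vec" where
  "slice n m p x = vec m (\<lambda>i. x $ (i * n + p))"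

lemma slice_carrier [simp]: "slice n m p x \<in> carrier_vec m"
  by (simp add: slice_def)

lemma slice_index [simp]: "i < m \<Longrightarrow> slice n m p x $ i = x $ (i * n + p)"
  by (simp add: slice_def)

lemma block_index_less:
  fixes i m n p :: nat
  assumes "i < m" "p < n"
  shows "i * n + p < m * n"
proof -
  have "i * n + p < Suc i * n" using assms by simp
  also have "\<dots> \<le> m * n" using assms by (intro mult_le_mono1) simp
  finally show ?thesis .
qed

lemma mod_less_of_less_mult: "k < m * n \<Longrightarrow> k mod n < (n::nat)"
  by (cases "n = 0") auto

lemma slice_zero: "p < n \<Longrightarrow> slice n m p (0\<^sub>v (m * n)) = 0\<^sub>v m"
  by (rule eq_vecI) (auto simp: slice_def block_index_less)

text \<open>Since \<open>j = (j div n) * n + j mod n\<close>, entry \<open>j\<close> is entry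
  \<open>j div n\<close> of the slice with offset \<open>j mod n\<close>.\<close>

lemma vec_eq_slicesI:
  assumes "x \<in> carrier_vec (m * n)" "y \<in> carrier_vec (m * n)"
    and "\<And>p. p < n \<Longrightarrow> slice n m p x = slice n m p y"
  shows "x = y"
proof (rule eq_vecI)
  fix j assume "j < dim_vec y"
  then have j: "j < m * n" using assms by auto
  then have p: "j mod n < n" and i: "j div n < m"
    by (auto simp: less_mult_imp_div_less mod_less_of_less_mult)
  have "slice n m (j mod n) x $ (j div n) = slice n m (j mod n) y $ (j div n)"
    using assms(3)[OF p] by simp
  with i show "x $ j = y $ j" by simp
qed (use assms in auto)

lemma kronecker_one_carrier:
  "C \<in> carrier_mat r m \<Longrightarrow> C \<otimes>\<^sub>K 1\<^sub>m n \<in> carrier_mat (r * n) (m * n)"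
  by (auto simp: kronecker_def)

text \<open>Row \<open>i * n + p\<close> of \<open>C \<otimes>\<^sub>K 1\<^sub>m n\<close> vanishes
  outside the columns congruent to \<open>p\<close> modulo \<open>n\<close>, and column
  \<open>j * n + p\<close> carries \<open>C $$ (i, j)\<close>. The product therefore never mixes
  different offsets.\<close>

lemma slice_kronecker_one_mult:
  fixes C :: "'a::comm_semiring_1 mat"
  assumes C: "C \<in> carrier_mat r m" and x: "x \<in> carrier_vec (m * n)" and p: "p < n"
  shows "slice n r p ((C \<otimes>\<^sub>K 1\<^sub>m n) *\<^sub>v x) = C *\<^sub>v slice n m p x"
proof (rule eq_vecI)
  fix i assume "i < dim_vec (C *\<^sub>v slice n m p x)"
  then have i: "i < r" using C by auto
  have "((C \<otimes>\<^sub>K 1\<^sub>m n) *\<^sub>v x) $ (i * n + p)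
      = (\<Sum>k<m * n. C $$ (i, k div n) * (if p = k mod n then 1 else 0) * x $ k)"
    using C x p block_index_less[OF i p]
    by (auto simp: kronecker_def scalar_prod_def lessThan_atLeast0 mod_less_of_less_mult
        intro!: sum.cong)
  \<comment> \<open>The columns are grouped by blocks; in block \<open>j\<close> only offset
    \<open>p\<close> survives.\<close>
  also have "\<dots> = (\<Sum>j<m. \<Sum>k\<in>{j * n..<j * n + n}.
      C $$ (i, k div n) * (if p = k mod n then 1 else 0) * x $ k)"
    by (rule sum.nat_group[symmetric])
  also have "\<dots> = (\<Sum>j<m. C $$ (i, j) * x $ (j * n + p))"
  proof (rule sum.cong[OF refl])
    fix j
    have "(\<Sum>k\<in>{j * n..<j * n + n}. C $$ (i, k div n) * (if p = k mod n then 1 else 0) * x $ k)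
      = (\<Sum>k\<in>{j * n + p}. C $$ (i, k div n) * (if p = k mod n then 1 else 0) * x $ k)"
    proof (rule sum.mono_neutral_right)
      show "\<forall>k\<in>{j * n..<j * n + n} - {j * n + p}.
          C $$ (i, k div n) * (if p = k mod n then 1 else 0) * x $ k = 0"
      proof
        fix k assume k: "k \<in> {j * n..<j * n + n} - {j * n + p}"
        define q where "q = k - j * n"
        have "k = j * n + q" "q < n" "q \<noteq> p" using k by (auto simp: q_def)
        then show "C $$ (i, k div n) * (if p = k mod n then 1 else 0) * x $ k = 0" by simp
      qed
    qed (use p in auto)
    also have "\<dots> = C $$ (i, j) * x $ (j * n + p)" using p by simp
    finally show "(\<Sum>k\<in>{j * n..<j * n + n}. C $$ (i, k div n) * (if p = k mod n then 1 else 0) * x $ k)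
      = C $$ (i, j) * x $ (j * n + p)" .
  qed
  finally show "slice n r p ((C \<otimes>\<^sub>K 1\<^sub>m n) *\<^sub>v x) $ i = (C *\<^sub>v slice n m p x) $ i"
    using C i by (auto simp: scalar_prod_def slice_def lessThan_atLeast0 intro!: sum.cong)
qed (use C in \<open>auto simp: slice_def\<close>)

text \<open>Every entry of \<open>C \<otimes>\<^sub>K 1\<^sub>m n\<close> is an entry of
  \<open>C\<close> or 0, so it is enough that \<open>f\<close> fixes 0. This covers extraction of a
  coefficient, which is not multiplicative.\<close>

lemma map_mat_kronecker_one:
  fixes C :: "'a::semiring_1 mat" and f :: "'a \<Rightarrow> 'b::semiring_1"
  assumes "f 0 = 0"
  shows "map_mat f (C \<otimes>\<^sub>K 1\<^sub>m n) = map_mat f C \<otimes>\<^sub>K 1\<^sub>m n"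
  using assms
  by (intro eq_matI) (auto simp: kronecker_def less_mult_imp_div_less mod_less_of_less_mult)

lemma transpose_map_mat: "transpose_mat (map_mat f C) = map_mat f (transpose_mat C)"
  by (rule eq_matI) auto

text \<open>Homogenized in \<open>\<lambda> = a / b\<close>: \<open>(\<mu>, 1)\<close> gives the value at \<open>\<mu>\<close>, and \<open>(1, 0)\<close> the leading
  coefficient, where \<open>0 ^ 0 = 1\<close> makes \<open>Lambda_hom k 1 0\<close> the first unit vector.\<close>

definition L_hom :: "nat \<Rightarrow> 'a \<Rightarrow> 'a \<Rightarrow> 'a::field mat" where
  "L_hom k a b = mat k (k + 1) (\<lambda>(i, j). if j = i then - b else if j = i + 1 then a else 0)"

definition Lambda_hom :: "nat \<Rightarrow> 'a \<Rightarrow> 'a \<Rightarrow> 'a::field mat" where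
  "Lambda_hom k a b = mat (k + 1) 1 (\<lambda>(i, _). a ^ (k - i) * b ^ i)"

lemma L_hom_carrier [simp]: "L_hom k a b \<in> carrier_mat k (k + 1)"
  by (simp add: L_hom_def)

lemma Lambda_hom_carrier [simp]: "Lambda_hom k a b \<in> carrier_mat (k + 1) 1"
  by (simp add: Lambda_hom_def)

lemma L_hom_mult_vec_index:
  assumes "u \<in> carrier_vec (k + 1)" and i: "i < k"
  shows "(L_hom k a b *\<^sub>v u) $ i = a * u $ (i + 1) - b * u $ i"
proof -
  have "(L_hom k a b *\<^sub>v u) $ i
      = (\<Sum>j<k + 1. (if j = i then - b else if j = i + 1 then a else 0) * u $ j)"
    using assms by (auto simp: L_hom_def scalar_prod_def lessThan_atLeast0 intro!: sum.cong)
  also have "\<dots> = (\<Sum>j\<in>{i, i + 1}. (if j = i then - b else if j = i + 1 then a else 0) * u $ j)"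
    using i by (intro sum.mono_neutral_right) auto
  finally show ?thesis by simp
qed

lemma L_hom_transpose_mult_vec_index:
  assumes "u \<in> carrier_vec k" and i: "i < k"
  shows "(transpose_mat (L_hom k a b) *\<^sub>v u) $ i = (if i = 0 then 0 else a * u $ (i - 1)) - b * u $ i"
    and "(transpose_mat (L_hom k a b) *\<^sub>v u) $ (i + 1)
      = a * u $ i - (if i + 1 < k then b * u $ (i + 1) else 0)"
proof -
  have row: "(transpose_mat (L_hom k a b) *\<^sub>v u) $ l
      = (\<Sum>j<k. (if l = j then - b else if l = j + 1 then a else 0) * u $ j)" if "l < k + 1" for l
    using assms that by (auto simp: L_hom_def scalar_prod_def lessThan_atLeast0 intro!: sum.cong)
  \<comment> \<open>Each column of \<open>L_hom k a b\<close> has at most two nonzero entries.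
    Writing it as a sum of two delta terms lets the sum collapse, with guards for the first and last
    columns.\<close>
  have split: "(if l = j then - b else if l = j + 1 then a else 0) * u $ j
      = (if j = l then - b * u $ l else 0) + (if l > 0 \<and> j = l - 1 then a * u $ (l - 1) else 0)"
    for l j by auto
  have row': "(transpose_mat (L_hom k a b) *\<^sub>v u) $ l
     = (if l < k then - b * u $ l else 0) + (if l > 0 then a * u $ (l - 1) else 0)" if "l < k + 1" for l
    unfolding row[OF that] split sum.distrib using that by (auto simp: sum.delta)
  show "(transpose_mat (L_hom k a b) *\<^sub>v u) $ i = (if i = 0 then 0 else a * u $ (i - 1)) - b * u $ i"
    using i by (subst row') auto
  show "(transpose_mat (L_hom k a b) *\<^sub>v u) $ (i + 1)
      = a * u $ i - (if i + 1 < k then b * u $ (i + 1) else 0)"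
    using i by (subst row') auto
qed

text \<open>With \<open>v i = a ^ (k - i) * b ^ i\<close>, both \<open>a * v (i + 1)\<close> and
  \<open>b * v i\<close> equal \<open>a ^ (k - i) * b ^ (i + 1)\<close>.\<close>

lemma L_hom_Lambda_hom: "L_hom k a b * Lambda_hom k a b = 0\<^sub>m k 1"
proof (rule eq_matI)
  fix i j assume ij: "i < dim_row (0\<^sub>m k 1)" "j < dim_col (0\<^sub>m k 1)"
  have "(L_hom k a b * Lambda_hom k a b) $$ (i, j) = (L_hom k a b *\<^sub>v col (Lambda_hom k a b) 0) $ i"
    using ij by (simp add: L_hom_def Lambda_hom_def)
  also have "\<dots> = a * (a ^ (k - (i + 1)) * b ^ (i + 1)) - b * (a ^ (k - i) * b ^ i)"
    using ij by (subst L_hom_mult_vec_index) (auto simp: Lambda_hom_def)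
  also have "a ^ (k - i) = a * a ^ (k - (i + 1))"
    using ij by (metis Suc_diff_Suc Suc_eq_plus1 power_Suc index_zero_mat(2))
  finally show "(L_hom k a b * Lambda_hom k a b) $$ (i, j) = 0\<^sub>m k 1 $$ (i, j)"
    using ij by (simp add: algebra_simps)
qed (auto simp: L_hom_def Lambda_hom_def)

text \<open>The recurrence \<open>a * u $ (i + 1) = b * u $ i\<close> leaves one free entry: the
  last if \<open>b = 1\<close>, the first at \<open>(1, 0)\<close>. The scalar multiple is written
  as a product with a vector of length 1, so that it can be matched with a slice of a single
  block.\<close>

lemma L_hom_kernel:
  assumes "u \<in> carrier_vec (k + 1)" and "L_hom k a b *\<^sub>v u = 0\<^sub>v k"
    and ab: "b = 1 \<or> (a = 1 \<and> b = 0)"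
  shows "u = Lambda_hom k a b *\<^sub>v vec 1 (\<lambda>_. u $ (if b = 0 then 0 else k))"
proof -
  have rec: "a * u $ (i + 1) = b * u $ i" if "i < k" for i
    using L_hom_mult_vec_index[OF assms(1) that, of a b] assms(2) that by simp
  have u_index: "u $ i = a ^ (k - i) * b ^ i * u $ (if b = 0 then 0 else k)" if "i < k + 1" for i
  proof (cases "b = 0")
    case True
    then show ?thesis using ab that rec[of "i - 1"] by (cases i) auto
  next
    case False
    then have b: "b = 1" using ab by auto
    have "i \<le> k" using that by simp
    \<comment> \<open>The recurrence determines \<open>u $ m\<close> from
      \<open>u $ (m + 1)\<close>, hence induction downwards from \<open>k\<close>.\<close>
    then have "u $ i = a ^ (k - i) * u $ k"
    proof (induction rule: inc_induct)
      case (step m)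
      then have "u $ m = a * u $ (m + 1)" using rec[of m] b by simp
      moreover have "k - m = Suc (k - Suc m)" using step by simp
      ultimately show ?case using step by simp
    qed simp
    then show ?thesis using b by simp
  qed
  show ?thesis
  proof (rule eq_vecI)
    fix i assume "i < dim_vec (Lambda_hom k a b *\<^sub>v vec 1 (\<lambda>_. u $ (if b = 0 then 0 else k)))"
    then have i: "i < k + 1" by (simp add: Lambda_hom_def)
    show "u $ i = (Lambda_hom k a b *\<^sub>v vec 1 (\<lambda>_. u $ (if b = 0 then 0 else k))) $ i"
      by (subst u_index[OF i]) (use i in \<open>simp add: Lambda_hom_def scalar_prod_def\<close>)
  qed (use assms(1) in \<open>simp add: Lambda_hom_def\<close>)
qed

text \<open>If \<open>b\<close> is nonzero, the first row gives \<open>u $ 0 = 0\<close> and the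
  following rows propagate this upwards. If \<open>b = 0\<close>, row \<open>i + 1\<close> reads
  \<open>a * u $ i = 0\<close>.\<close>

lemma L_hom_transpose_injective:
  assumes u: "u \<in> carrier_vec k" and "transpose_mat (L_hom k a b) *\<^sub>v u = 0\<^sub>v (k + 1)"
    and ab: "a \<noteq> 0 \<or> b \<noteq> 0"
  shows "u = 0\<^sub>v k"
proof -
  note row = L_hom_transpose_mult_vec_index[OF u, of _ a b, unfolded assms(2)]
  have "u $ i = 0" if "i < k" for i
  proof (cases "b = 0")
    case True
    then show ?thesis using row(2)[OF that] that ab by (auto split: if_splits)
  next
    case False
    then show ?thesis using that
    proof (induction i)
      case 0
      then show ?case using row(1)[of 0] by simp
    next
      case (Suc i)
      then show ?case using row(1)[of "Suc i"] by simp
    qed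
  qed
  then show ?thesis using u by (intro eq_vecI) auto
qed

section \<open>Kernel vectors of the block matrix, for both kinds of eigenvalue\<close>

text \<open>\<open>M\<close> stands for the value of \<lambda>B + A at a point or for its leading
  coefficient, and \<open>c\<close> for the image of \<sigma>. The block \<open>w\<close> sits where
  \<open>Lambda_hom s a b\<close> has entry 1; the \<open>+ 1\<close> is due to blocks being
  numbered from 1.\<close>

lemma block_kronecker_eigenvector:
  fixes M :: "'a::field mat"
  assumes M: "M \<in> carrier_mat ((s + 1) * n) ((s + 1) * n)"
    and ab: "b = 1 \<or> (a = 1 \<and> b = 0)" and c: "c \<noteq> 0"
    and z: "z \<in> carrier_vec ((s + 1) * n + s * n)" "z \<noteq> 0\<^sub>v ((s + 1) * n + s * n)"
    and eq: "four_block_mat M (transpose_mat (L_hom s a b) \<otimes>\<^sub>K 1\<^sub>m n)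
        (c \<cdot>\<^sub>m (L_hom s a b \<otimes>\<^sub>K 1\<^sub>m n)) (0\<^sub>m (s * n) (s * n)) *\<^sub>v z = 0\<^sub>v ((s + 1) * n + s * n)"
  defines "w \<equiv> block n ((if b = 0 then 0 else s) + 1) z"
  shows "w \<noteq> 0\<^sub>v n"
    and "((transpose_mat (Lambda_hom s a b) \<otimes>\<^sub>K 1\<^sub>m n) * M * (Lambda_hom s a b \<otimes>\<^sub>K 1\<^sub>m n)) *\<^sub>v w = 0\<^sub>v n"
proof -
  let ?L = "L_hom s a b" and ?V = "Lambda_hom s a b"
  let ?k = "if b = 0 then 0 else s"
  define x where "x = vec_first z ((s + 1) * n)"
  define y where "y = vec_last z (s * n)"
  have x: "x \<in> carrier_vec ((s + 1) * n)" and y: "y \<in> carrier_vec (s * n)"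
    by (auto simp: x_def y_def)
  have z_split: "z = x @\<^sub>v y" using z(1) by (simp add: x_def y_def)
  have w: "w \<in> carrier_vec n" by (simp add: w_def block_def)
  have LT: "transpose_mat ?L \<in> carrier_mat (s + 1) s" and VT: "transpose_mat ?V \<in> carrier_mat 1 (s + 1)"
    by (simp_all only: transpose_carrier_mat L_hom_carrier Lambda_hom_carrier)
  note LK = kronecker_one_carrier[OF L_hom_carrier, of s a b n]
    and LTK = kronecker_one_carrier[OF LT, of n]
    and VK = kronecker_one_carrier[OF Lambda_hom_carrier, of s a b n]
    and VTK = kronecker_one_carrier[OF VT, of n]
  have zero_split: "0\<^sub>v ((s + 1) * n + s * n) = 0\<^sub>v ((s + 1) * n) @\<^sub>v (0\<^sub>v (s * n) :: 'a vec)"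
    by (rule eq_vecI) auto
  have "(M *\<^sub>v x + (transpose_mat ?L \<otimes>\<^sub>K 1\<^sub>m n) *\<^sub>v y)
      @\<^sub>v ((c \<cdot>\<^sub>m (?L \<otimes>\<^sub>K 1\<^sub>m n)) *\<^sub>v x + 0\<^sub>m (s * n) (s * n) *\<^sub>v y)
      = 0\<^sub>v ((s + 1) * n) @\<^sub>v 0\<^sub>v (s * n)"
    using eq unfolding z_split zero_split
    by (subst (asm) four_block_mat_mult_vec[OF M LTK _ _ x y]) (use LK in auto)
  then have top: "M *\<^sub>v x + (transpose_mat ?L \<otimes>\<^sub>K 1\<^sub>m n) *\<^sub>v y = 0\<^sub>v ((s + 1) * n)"
    and bot: "(c \<cdot>\<^sub>m (?L \<otimes>\<^sub>K 1\<^sub>m n)) *\<^sub>v x + 0\<^sub>m (s * n) (s * n) *\<^sub>v y = 0\<^sub>v (s * n)"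
    using M x y LTK by (subst (asm) append_vec_eq[of _ "(s + 1) * n"], auto)+
  \<comment> \<open>The zero block contributes nothing and the nonzero factor \<open>c\<close>
    cancels.\<close>
  have Lx: "(?L \<otimes>\<^sub>K 1\<^sub>m n) *\<^sub>v x = 0\<^sub>v (s * n)"
  proof (rule eq_vecI)
    fix i assume i: "i < dim_vec (0\<^sub>v (s * n) :: 'a vec)"
    have "((c \<cdot>\<^sub>m (?L \<otimes>\<^sub>K 1\<^sub>m n)) *\<^sub>v x + 0\<^sub>m (s * n) (s * n) *\<^sub>v y) $ i
        = c * ((?L \<otimes>\<^sub>K 1\<^sub>m n) *\<^sub>v x) $ i"
      using i LK x y by (simp add: scalar_prod_def sum_distrib_left mult.assoc)
    with bot i c show "((?L \<otimes>\<^sub>K 1\<^sub>m n) *\<^sub>v x) $ i = 0\<^sub>v (s * n) $ i" by simp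
  qed (use LK in auto)
  \<comment> \<open>This brings the free entry of each slice of \<open>x\<close> into the form used
    by \<open>L_hom_kernel\<close>.\<close>
  have slice_w: "slice n 1 p w = vec 1 (\<lambda>_. slice n (s + 1) p x $ ?k)" if p: "p < n" for p
    using p block_index_less[of ?k "s + 1" p n]
    by (intro eq_vecI) (auto simp: w_def block_def slice_def x_def vec_first_def)
  have x_w: "x = (?V \<otimes>\<^sub>K 1\<^sub>m n) *\<^sub>v w"
  proof (rule vec_eq_slicesI[of _ "s + 1" n])
    fix p assume p: "p < n"
    have "?L *\<^sub>v slice n (s + 1) p x = 0\<^sub>v s"
      using slice_kronecker_one_mult[OF L_hom_carrier x p, of a b] unfolding Lx slice_zero[OF p]
      by (rule sym)
    from L_hom_kernel[OF slice_carrier this ab]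
    have "slice n (s + 1) p x = ?V *\<^sub>v slice n 1 p w" unfolding slice_w[OF p] .
    also have "\<dots> = slice n (s + 1) p ((?V \<otimes>\<^sub>K 1\<^sub>m n) *\<^sub>v w)"
      by (rule slice_kronecker_one_mult[symmetric, OF Lambda_hom_carrier _ p]) (use w in simp)
    finally show "slice n (s + 1) p x = slice n (s + 1) p ((?V \<otimes>\<^sub>K 1\<^sub>m n) *\<^sub>v w)" .
  qed (use x VK w in auto)
  show "w \<noteq> 0\<^sub>v n"
  proof
    assume "w = 0\<^sub>v n"
    then have x0: "x = 0\<^sub>v ((s + 1) * n)" using VK unfolding x_w by (intro eq_vecI) auto
    have LTy: "(transpose_mat ?L \<otimes>\<^sub>K 1\<^sub>m n) *\<^sub>v y = 0\<^sub>v ((s + 1) * n)"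
    proof -
      have "M *\<^sub>v x = 0\<^sub>v ((s + 1) * n)" using M x0 by (intro eq_vecI) auto
      then show ?thesis using top LTK y by auto
    qed
    have "y = 0\<^sub>v (s * n)"
    proof (rule vec_eq_slicesI[of _ s n])
      fix p assume p: "p < n"
      have "transpose_mat ?L *\<^sub>v slice n s p y = 0\<^sub>v (s + 1)"
        using slice_kronecker_one_mult[OF LT y p] unfolding LTy slice_zero[OF p] by (rule sym)
      then have "slice n s p y = 0\<^sub>v s"
        by (rule L_hom_transpose_injective[OF slice_carrier]) (use ab in auto)
      then show "slice n s p y = slice n s p (0\<^sub>v (s * n))" unfolding slice_zero[OF p] .
    qed (use y in auto)
    with x0 z(2) zero_split show False by (simp add: z_split)
  qed
  \<comment> \<open>On slices this is the transpose of \<open>L_hom_Lambda_hom\<close>.\<close>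
  have VLT: "(transpose_mat ?V \<otimes>\<^sub>K 1\<^sub>m n) *\<^sub>v ((transpose_mat ?L \<otimes>\<^sub>K 1\<^sub>m n) *\<^sub>v y) = 0\<^sub>v (1 * n)"
  proof (rule vec_eq_slicesI[of _ 1 n])
    fix p assume p: "p < n"
    have "transpose_mat ?V *\<^sub>v (transpose_mat ?L *\<^sub>v slice n s p y)
        = transpose_mat (?L * ?V) *\<^sub>v slice n s p y"
      using assoc_mult_mat_vec[OF VT LT slice_carrier]
        transpose_mult[OF L_hom_carrier Lambda_hom_carrier] by metis
    also have "\<dots> = 0\<^sub>v 1" unfolding L_hom_Lambda_hom by (rule eq_vecI) auto
    finally show "slice n 1 p ((transpose_mat ?V \<otimes>\<^sub>K 1\<^sub>m n) *\<^sub>v ((transpose_mat ?L \<otimes>\<^sub>K 1\<^sub>m n) *\<^sub>v y))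
        = slice n 1 p (0\<^sub>v (1 * n))"
      unfolding slice_kronecker_one_mult[OF VT mult_mat_vec_carrier[OF LTK y] p]
        slice_kronecker_one_mult[OF LT y p] slice_zero[OF p] .
  qed (use VTK LTK y in auto)
  have "((transpose_mat ?V \<otimes>\<^sub>K 1\<^sub>m n) * M * (?V \<otimes>\<^sub>K 1\<^sub>m n)) *\<^sub>v w = (transpose_mat ?V \<otimes>\<^sub>K 1\<^sub>m n) *\<^sub>v (M *\<^sub>v x)"
  proof -
    have w1: "w \<in> carrier_vec (1 * n)" using w by simp
    show ?thesis unfolding x_w
      by (rule trans[OF assoc_mult_mat_vec[OF mult_carrier_mat[OF VTK M] VK w1]
          assoc_mult_mat_vec[OF VTK M mult_mat_vec_carrier[OF VK w1]]])
  qed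
  \<comment> \<open>Adding the vanishing term \<open>VLT\<close> completes
    \<open>M *\<^sub>v x\<close> to the upper block row, which is zero by
    \<open>top\<close>.\<close>
  also have "\<dots> = (transpose_mat ?V \<otimes>\<^sub>K 1\<^sub>m n) *\<^sub>v (M *\<^sub>v x)
      + (transpose_mat ?V \<otimes>\<^sub>K 1\<^sub>m n) *\<^sub>v ((transpose_mat ?L \<otimes>\<^sub>K 1\<^sub>m n) *\<^sub>v y)"
    unfolding VLT
    by (rule right_zero_vec[symmetric, OF mult_mat_vec_carrier[OF VTK mult_mat_vec_carrier[OF M x]]])
  also have "\<dots> = (transpose_mat ?V \<otimes>\<^sub>K 1\<^sub>m n) *\<^sub>v (M *\<^sub>v x + (transpose_mat ?L \<otimes>\<^sub>K 1\<^sub>m n) *\<^sub>v y)"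
    by (rule mult_add_distrib_mat_vec[symmetric, OF VTK mult_mat_vec_carrier[OF M x]
          mult_mat_vec_carrier[OF LTK y]])
  also have "\<dots> = 0\<^sub>v n" unfolding top using VTK by (intro eq_vecI) auto
  finally show "((transpose_mat ?V \<otimes>\<^sub>K 1\<^sub>m n) * M * (?V \<otimes>\<^sub>K 1\<^sub>m n)) *\<^sub>v w = 0\<^sub>v n" .
qed

section \<open>Images of the pencil under entrywise maps\<close>

lemma map_mat_L_mat:
  assumes "f 0 = 0" "f (-1) = - b" "f [:0, 1:] = a"
  shows "map_mat f (L_mat s) = L_hom s a b"
  using assms by (intro eq_matI) (auto simp: L_mat_def L_hom_def)

text \<open>The hypotheses on \<open>f\<close> fit both evaluation at a point and extraction of the
  coefficient of \<lambda>. The latter respects products with the constant \<sigma> but not products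
  in general.\<close>

lemma map_mat_block_kronecker_pencil:
  assumes AB: "A \<in> carrier_mat ((s + 1) * n) ((s + 1) * n)" "B \<in> carrier_mat ((s + 1) * n) ((s + 1) * n)"
    and f: "f 0 = 0" "f (-1) = - b" "f [:0, 1:] = a" "\<And>q. f ([:\<sigma>:] * q) = c * f q"
  shows "map_mat f (block_kronecker_pencil n s \<sigma> B A) =
    four_block_mat (map_mat f (linear_pencil B A)) (transpose_mat (L_hom s a b) \<otimes>\<^sub>K 1\<^sub>m n)
      (c \<cdot>\<^sub>m (L_hom s a b \<otimes>\<^sub>K 1\<^sub>m n)) (0\<^sub>m (s * n) (s * n))"
proof -
  have L: "L_mat s \<in> carrier_mat s (s + 1)" by (simp add: L_mat_def)
  then have LT: "transpose_mat (L_mat s) \<in> carrier_mat (s + 1) s"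
    by (simp only: transpose_carrier_mat)
  have M: "linear_pencil B A \<in> carrier_mat ((s + 1) * n) ((s + 1) * n)"
    using AB by (simp add: linear_pencil_def)
  note LK = kronecker_one_carrier[OF L, of n] and LTK = kronecker_one_carrier[OF LT, of n]
  have "map_mat f ([:\<sigma>:] \<cdot>\<^sub>m (L_mat s \<otimes>\<^sub>K 1\<^sub>m n)) = c \<cdot>\<^sub>m map_mat f (L_mat s \<otimes>\<^sub>K 1\<^sub>m n)"
    by (rule eq_matI) (simp_all only: index_map_mat index_smult_mat f(4))
  moreover have "map_mat f (0\<^sub>m (s * n) (s * n)) = 0\<^sub>m (s * n) (s * n)"
    using f(1) by (intro eq_matI) auto
  ultimately show ?thesis
    unfolding block_kronecker_pencil_def
    by (subst map_four_block_mat[OF M LTK smult_carrier_mat[OF LK] zero_carrier_mat])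
      (simp add: map_mat_kronecker_one[of f, OF f(1)] map_mat_L_mat[of f, OF f(1-3)]
        transpose_map_mat[symmetric])
qed

section \<open>Leading coefficients of products of matrix polynomials\<close>

text \<open>For \<open>i\<close> other than \<open>g\<close>, either \<open>i > g\<close> or
  \<open>g + h - i > h\<close>, so one factor of the convolution term is zero.\<close>

lemma coeff_mult_degree_le:
  fixes p q :: "'a::comm_semiring_0 poly"
  assumes "degree p \<le> g" "degree q \<le> h"
  shows "coeff (p * q) (g + h) = coeff p g * coeff q h"
proof -
  have "coeff (p * q) (g + h) = (\<Sum>i\<le>g + h. coeff p i * coeff q (g + h - i))"
    by (rule coeff_mult)
  also have "\<dots> = (\<Sum>i\<in>{g}. coeff p i * coeff q (g + h - i))"
  proof (rule sum.mono_neutral_right)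
    show "\<forall>i\<in>{..g + h} - {g}. coeff p i * coeff q (g + h - i) = 0"
    proof
      fix i assume "i \<in> {..g + h} - {g}"
      then have "i > g \<or> g + h - i > h" by auto
      then show "coeff p i * coeff q (g + h - i) = 0"
        using assms by (auto simp: coeff_eq_0)
    qed
  qed auto
  finally show ?thesis by simp
qed

lemma mat_mult_index_sum:
  "A \<in> carrier_mat nr m \<Longrightarrow> B \<in> carrier_mat m nc \<Longrightarrow> i < nr \<Longrightarrow> j < nc \<Longrightarrow>
    (A * B) $$ (i, j) = (\<Sum>k<m. A $$ (i, k) * B $$ (k, j))"
  by (auto simp: scalar_prod_def lessThan_atLeast0 intro!: sum.cong)

lemma degree_mat_mult_le:
  fixes A B :: "'a::comm_semiring_1 poly mat"
  assumes "A \<in> carrier_mat nr m" "B \<in> carrier_mat m nc"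
    and "\<And>i k. i < nr \<Longrightarrow> k < m \<Longrightarrow> degree (A $$ (i, k)) \<le> g"
    and "\<And>k j. k < m \<Longrightarrow> j < nc \<Longrightarrow> degree (B $$ (k, j)) \<le> h"
    and "i < nr" "j < nc"
  shows "degree ((A * B) $$ (i, j)) \<le> g + h"
  unfolding mat_mult_index_sum[OF assms(1,2,5,6)]
  using assms by (intro degree_sum_le) (auto intro: order.trans[OF degree_mult_le add_mono])

lemma coeff_mat_carrier: "R \<in> carrier_mat nr nc \<Longrightarrow> coeff_mat R k \<in> carrier_mat nr nc"
  by (simp add: coeff_mat_def)

text \<open>At the sum of the degree bounds, taking coefficients is multiplicative. This replaces
  the homomorphism property of evaluation when the eigenvalue is \<infinity>.\<close>

lemma coeff_mat_mult:
  fixes A B :: "'a::comm_semiring_1 poly mat"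
  assumes A: "A \<in> carrier_mat nr m" and B: "B \<in> carrier_mat m nc"
    and "\<And>i k. i < nr \<Longrightarrow> k < m \<Longrightarrow> degree (A $$ (i, k)) \<le> g"
    and "\<And>k j. k < m \<Longrightarrow> j < nc \<Longrightarrow> degree (B $$ (k, j)) \<le> h"
  shows "coeff_mat (A * B) (g + h) = coeff_mat A g * coeff_mat B h"
proof (rule eq_matI)
  fix i j assume "i < dim_row (coeff_mat A g * coeff_mat B h)" "j < dim_col (coeff_mat A g * coeff_mat B h)"
  then have ij: "i < nr" "j < nc" using A B by (auto simp: coeff_mat_def)
  have "coeff_mat (A * B) (g + h) $$ (i, j) = coeff ((A * B) $$ (i, j)) (g + h)"
    using A B ij by (simp add: coeff_mat_def)
  also have "\<dots> = (\<Sum>k<m. coeff (A $$ (i, k)) g * coeff (B $$ (k, j)) h)"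
    unfolding mat_mult_index_sum[OF A B ij] coeff_sum
    using assms(3,4) ij by (intro sum.cong) (auto simp: coeff_mult_degree_le)
  also have "\<dots> = (coeff_mat A g * coeff_mat B h) $$ (i, j)"
    using A B ij by (subst mat_mult_index_sum[of _ nr m _ nc]) (auto simp: coeff_mat_def)
  finally show "coeff_mat (A * B) (g + h) $$ (i, j) = (coeff_mat A g * coeff_mat B h) $$ (i, j)" .
qed (use A B in \<open>auto simp: coeff_mat_def\<close>)

lemma degree_kronecker_one_le:
  fixes C :: "'a::comm_semiring_1 poly mat"
  assumes "C \<in> carrier_mat r m" "\<And>i j. i < r \<Longrightarrow> j < m \<Longrightarrow> degree (C $$ (i, j)) \<le> g"
    and "i < r * n" "j < m * n"
  shows "degree ((C \<otimes>\<^sub>K 1\<^sub>m n) $$ (i, j)) \<le> g"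
proof -
  have "i div n < r" "j div n < m" using assms by (auto intro: less_mult_imp_div_less)
  moreover have "i mod n < n" "j mod n < n" using assms by (auto intro: mod_less_of_less_mult)
  ultimately show ?thesis using assms by (auto simp: kronecker_def)
qed

lemma degree_linear_pencil_le:
  assumes "A \<in> carrier_mat m m" "B \<in> carrier_mat m m" "i < m" "j < m"
  shows "degree (linear_pencil B A $$ (i, j)) \<le> 1"
  using assms by (auto simp: linear_pencil_def degree_pCons_eq_if)

section \<open>Evaluation and reversal over the algebraic closure\<close>

interpretation to_ac: comm_ring_hom to_ac
  by unfold_locales auto

lemma eval_ac_comm_ring_hom: "comm_ring_hom (\<lambda>p. poly (map_poly to_ac p) a)"
proof -
  have "map_poly to_ac (p * q) = map_poly to_ac p * map_poly to_ac q" for p q :: "'a poly"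
    by (rule poly_eqI) (simp add: coeff_map_poly coeff_mult to_ac_sum)
  moreover have "map_poly to_ac (p + q) = map_poly to_ac p + map_poly to_ac q" for p q :: "'a poly"
    by (rule poly_eqI) (simp add: coeff_map_poly)
  ultimately show ?thesis by unfold_locales auto
qed

lemma eval_ac_sandwich:
  assumes R: "R \<in> carrier_mat m m" and V: "V \<in> carrier_mat m n"
    and W: "W \<in> carrier_mat n m"
  shows "eval_ac (W * R * V) \<mu> = eval_ac W \<mu> * eval_ac R \<mu> * eval_ac V \<mu>"
proof -
  interpret comm_ring_hom "\<lambda>p. poly (map_poly to_ac p) \<mu>" by (rule eval_ac_comm_ring_hom)
  show ?thesis unfolding eval_ac_def
    by (subst mat_hom_mult[OF mult_carrier_mat[OF W R] V], subst mat_hom_mult[OF W R]) (rule refl)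
qed

text \<open>Among the exponents \<open>g - k\<close> with \<open>k \<le> g\<close>, only
  \<open>k = g\<close> gives 0, so the constant term of the reversal is the coefficient at
  \<open>g\<close>.\<close>

lemma eval_ac_rev_mat_poly_0: "eval_ac (rev_mat_poly g R) 0 = map_mat to_ac (coeff_mat R g)"
proof -
  have "poly (map_poly to_ac (rev_poly g p)) 0 = to_ac (coeff p g)" for p :: "'a poly"
  proof -
    have "coeff (rev_poly g p) 0 = (\<Sum>k\<le>g. if k = g then coeff p k else 0)"
      unfolding rev_poly_def coeff_sum by (rule sum.cong) auto
    then show ?thesis by (simp add: poly_0_coeff_0 coeff_map_poly)
  qed
  then show ?thesis
    by (intro eq_matI) (auto simp: eval_ac_def rev_mat_poly_def coeff_mat_def)
qed

lemma block_carrier [simp]: "block n i z \<in> carrier_vec n"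
  by (simp add: block_def)

lemma map_vec_block:
  assumes "z \<in> carrier_vec (m * n)" "1 \<le> i" "i \<le> m"
  shows "map_vec f (block n i z) = block n i (map_vec f z)"
proof (rule eq_vecI)
  fix j assume "j < dim_vec (block n i (map_vec f z))"
  then have j: "j < n" by (simp add: block_def)
  then have "(i - 1) * n + j < m * n" using assms by (intro block_index_less) auto
  then show "map_vec f (block n i z) $ j = block n i (map_vec f z) $ j"
    using j assms by (simp add: block_def)
qed (simp add: block_def)

theorem theorem7p1:
  fixes P :: "'a::field poly mat"
    and A B :: "'a mat"
    and \<sigma> :: 'a
    and n d s :: nat
    and \<L> :: "'a poly mat"
  assumes P: "P \<in> carrier_mat n n" "regular P" "has_degree P d"
    and d: "odd d" "s = (d - 1) div 2" "s \<ge> 1"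
    and AB: "A \<in> carrier_mat ((s + 1) * n) ((s + 1) * n)" "B \<in> carrier_mat ((s + 1) * n) ((s + 1) * n)"
    and \<sigma>: "\<sigma> \<in> {1, -1}"
    and linearization:
      "(transpose_mat (Lambda_col s) \<otimes>\<^sub>K 1\<^sub>m n) * linear_pencil B A * (Lambda_col s \<otimes>\<^sub>K 1\<^sub>m n) = P"
    and \<L>: "\<L> = block_kronecker_pencil n s \<sigma> B A"
  shows "(\<forall>z :: 'a vec. \<forall>\<mu> :: 'a alg_closure.
            z \<in> carrier_vec (n * d) \<and> right_eigenvector \<L> \<mu> (map_vec to_ac z) \<longrightarrow>
            right_eigenvector P \<mu> (map_vec to_ac (block n (s + 1) z)))
       \<and> (\<forall>z :: 'a vec.
            z \<in> carrier_vec (n * d) \<and> right_eigenvector_inf 1 \<L> (map_vec to_ac z) \<longrightarrow>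
            right_eigenvector_inf d P (map_vec to_ac (block n 1 z)))"
proof -
  let ?N = "(s + 1) * n + s * n"
  let ?M = "linear_pencil B A" and ?V = "Lambda_col s :: 'a poly mat"
  have d': "d = s + 1 + s" using d by presburger
  \<comment> \<open>The length is needed both split as in the block matrix and, for
    \<open>map_vec_block\<close>, as a multiple of \<open>n\<close>.\<close>
  have nd: "n * d = ?N" unfolding d' by (simp add: algebra_simps)
  have nd': "n * d = (s + 1 + s) * n" unfolding d' by simp
  have \<sigma>0: "to_ac \<sigma> \<noteq> 0" using \<sigma> by auto
  have M: "?M \<in> carrier_mat ((s + 1) * n) ((s + 1) * n)"
    using AB by (simp add: linear_pencil_def)
  have V: "?V \<in> carrier_mat (s + 1) 1" by (simp add: Lambda_col_def)
  then have VT: "transpose_mat ?V \<in> carrier_mat 1 (s + 1)" by (simp only: transpose_carrier_mat)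
  have VK: "?V \<otimes>\<^sub>K 1\<^sub>m n \<in> carrier_mat ((s + 1) * n) n"
    using kronecker_one_carrier[OF V, of n] by simp
  have VTK: "transpose_mat ?V \<otimes>\<^sub>K 1\<^sub>m n \<in> carrier_mat n ((s + 1) * n)"
    using kronecker_one_carrier[OF VT, of n] by simp
  have dims: "dim_row \<L> = ?N" "dim_col \<L> = ?N"
    using M unfolding \<L> block_kronecker_pencil_def by (auto simp: kronecker_def L_mat_def)

  \<comment> \<open>Finite eigenvalue: everything is evaluated at \<mu>, with homogeneous
    coordinates \<open>(\<mu>, 1)\<close>.\<close>
  have "right_eigenvector P \<mu> (map_vec to_ac (block n (s + 1) z))"
    if z: "z \<in> carrier_vec (n * d)" and ev: "right_eigenvector \<L> \<mu> (map_vec to_ac z)"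
    for z :: "'a vec" and \<mu>
  proof -
    interpret ev: comm_ring_hom "\<lambda>p. poly (map_poly to_ac p) \<mu>" by (rule eval_ac_comm_ring_hom)
    have *: "eval_ac \<L> \<mu> = four_block_mat (eval_ac ?M \<mu>) (transpose_mat (L_hom s \<mu> 1) \<otimes>\<^sub>K 1\<^sub>m n)
      (to_ac \<sigma> \<cdot>\<^sub>m (L_hom s \<mu> 1 \<otimes>\<^sub>K 1\<^sub>m n)) (0\<^sub>m (s * n) (s * n))"
      unfolding \<L> eval_ac_def
      by (rule map_mat_block_kronecker_pencil[OF AB], simp, simp only: ev.hom_uminus ev.hom_one, 
          simp add: map_poly_pCons, simp only: ev.hom_mult, simp add: map_poly_pCons)
    have V_eval: "map_mat (\<lambda>p. poly (map_poly to_ac p) \<mu>) ?V = Lambda_hom s \<mu> 1"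
      by (intro eq_matI) (auto simp: Lambda_col_def Lambda_hom_def map_poly_monom poly_monom)
    have "eval_ac P \<mu> = eval_ac (transpose_mat ?V \<otimes>\<^sub>K 1\<^sub>m n) \<mu> * eval_ac ?M \<mu> * eval_ac (?V \<otimes>\<^sub>K 1\<^sub>m n) \<mu>"
      unfolding linearization[symmetric] by (rule eval_ac_sandwich[OF M VK VTK])
    also have "\<dots> = (transpose_mat (Lambda_hom s \<mu> 1) \<otimes>\<^sub>K 1\<^sub>m n) * eval_ac ?M \<mu> * (Lambda_hom s \<mu> 1 \<otimes>\<^sub>K 1\<^sub>m n)"
      unfolding eval_ac_def
      by (simp add: map_mat_kronecker_one transpose_map_mat[symmetric] V_eval)
    finally have P_eval: "eval_ac P \<mu> = \<dots>" .
    have M_ac: "eval_ac ?M \<mu> \<in> carrier_mat ((s + 1) * n) ((s + 1) * n)"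
      using M by (simp add: eval_ac_def)
    have z_ac: "map_vec to_ac z \<in> carrier_vec ?N" using z by (simp only: nd map_carrier_vec)
    \<comment> \<open>\<open>core\<close> concerns the block of the embedded vector, the goal the
      embedded block of \<open>z\<close>; \<open>map_vec_block\<close> identifies the two.\<close>
    note core = block_kronecker_eigenvector[OF M_ac _ \<sigma>0 z_ac, where a = \<mu> and b = 1, folded *, simplified]
    show ?thesis
      using core ev P(1) z
      unfolding right_eigenvector_def dims P_eval
      by (subst (1 2 3) map_vec_block[OF z[unfolded nd']]) auto
  qed
  \<comment> \<open>Eigenvalue \<infinity>: evaluation gives way to coefficients, at 1 for the
    pencil and at \<open>d\<close> for \<open>P\<close>. The entries -1 and \<lambda> of
    \<open>L_mat s\<close> become 0 and 1, that is, coordinates \<open>(1, 0)\<close>.\<close>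
  moreover have "right_eigenvector_inf d P (map_vec to_ac (block n 1 z))"
    if z: "z \<in> carrier_vec (n * d)" and ev: "right_eigenvector_inf 1 \<L> (map_vec to_ac z)"
    for z :: "'a vec"
  proof -
    have *: "map_mat to_ac (coeff_mat \<L> 1) = four_block_mat (map_mat to_ac (coeff_mat ?M 1))
      (transpose_mat (L_hom s 1 0) \<otimes>\<^sub>K 1\<^sub>m n)
      (to_ac \<sigma> \<cdot>\<^sub>m (L_hom s 1 0 \<otimes>\<^sub>K 1\<^sub>m n)) (0\<^sub>m (s * n) (s * n))"
    proof -
      have "map_mat to_ac (coeff_mat R 1) = map_mat (\<lambda>p. to_ac (coeff p 1)) R" for R :: "'a poly mat"
        by (rule eq_matI) (auto simp: coeff_mat_def)
      then show ?thesis unfolding \<L>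
        using map_mat_block_kronecker_pencil[OF AB, of "\<lambda>p. to_ac (coeff p 1)" 0 1 \<sigma> "to_ac \<sigma>"]
        by simp
    qed
    \<comment> \<open>\<open>monom 1 (s - i)\<close> has a nonzero coefficient at \<open>s\<close>
      only for \<open>i = 0\<close>, in agreement with \<open>0 ^ i\<close>.\<close>
    have V_coeff: "map_mat to_ac (map_mat (\<lambda>p. coeff p s) ?V) = Lambda_hom s 1 0"
      using d(3) by (intro eq_matI) (auto simp: Lambda_col_def Lambda_hom_def power_0_left)
    have "coeff_mat P d = coeff_mat (transpose_mat ?V \<otimes>\<^sub>K 1\<^sub>m n) s * coeff_mat ?M 1 * coeff_mat (?V \<otimes>\<^sub>K 1\<^sub>m n) s"
    proof -
      have VTdeg: "degree ((transpose_mat ?V \<otimes>\<^sub>K 1\<^sub>m n) $$ (i, j)) \<le> s" if "i < n" "j < (s + 1) * n" for i j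
        using that by (intro degree_kronecker_one_le[OF VT])
          (auto simp: Lambda_col_def degree_monom_eq)
      have Vdeg: "degree ((?V \<otimes>\<^sub>K 1\<^sub>m n) $$ (i, j)) \<le> s" if "i < (s + 1) * n" "j < n" for i j
        using that by (intro degree_kronecker_one_le[OF V])
          (auto simp: Lambda_col_def degree_monom_eq)
      note Mdeg = degree_linear_pencil_le[OF AB]
      \<comment> \<open>The degree bounds \<open>s\<close>, 1 and \<open>s\<close> of the three
        factors add up to \<open>d\<close>. The form \<open>s + 1 + s\<close> follows the bracketing
        of the product, so \<open>coeff_mat_mult\<close> applies twice.\<close>
      have "coeff_mat P d = coeff_mat ((transpose_mat ?V \<otimes>\<^sub>K 1\<^sub>m n) * ?M) (s + 1) * coeff_mat (?V \<otimes>\<^sub>K 1\<^sub>m n) s"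
        unfolding linearization[symmetric] d'
        by (rule coeff_mat_mult[OF mult_carrier_mat[OF VTK M] VK])
          (use degree_mat_mult_le[OF VTK M VTdeg Mdeg] Vdeg in auto)
      also have "coeff_mat ((transpose_mat ?V \<otimes>\<^sub>K 1\<^sub>m n) * ?M) (s + 1)
          = coeff_mat (transpose_mat ?V \<otimes>\<^sub>K 1\<^sub>m n) s * coeff_mat ?M 1"
        by (rule coeff_mat_mult[OF VTK M VTdeg Mdeg])
      finally show ?thesis .
    qed
    then have "map_mat to_ac (coeff_mat P d) = map_mat to_ac (coeff_mat (transpose_mat ?V \<otimes>\<^sub>K 1\<^sub>m n) s)
        * map_mat to_ac (coeff_mat ?M 1) * map_mat to_ac (coeff_mat (?V \<otimes>\<^sub>K 1\<^sub>m n) s)"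
      using to_ac.mat_hom_mult[OF mult_carrier_mat[OF coeff_mat_carrier[OF VTK] coeff_mat_carrier[OF M]]
          coeff_mat_carrier[OF VK]]
        to_ac.mat_hom_mult[OF coeff_mat_carrier[OF VTK] coeff_mat_carrier[OF M]]
      by (simp only:)
    also have "\<dots> = (transpose_mat (Lambda_hom s 1 0) \<otimes>\<^sub>K 1\<^sub>m n) * map_mat to_ac (coeff_mat ?M 1)
        * (Lambda_hom s 1 0 \<otimes>\<^sub>K 1\<^sub>m n)"
      unfolding coeff_mat_def
      by (simp add: map_mat_kronecker_one transpose_map_mat[symmetric] V_coeff)
    finally have P_coeff: "map_mat to_ac (coeff_mat P d) = \<dots>" .
    have M_ac: "map_mat to_ac (coeff_mat ?M 1) \<in> carrier_mat ((s + 1) * n) ((s + 1) * n)"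
      using M by (simp add: coeff_mat_def)
    have z_ac: "map_vec to_ac z \<in> carrier_vec ?N" using z by (simp only: nd map_carrier_vec)
    note core = block_kronecker_eigenvector[OF M_ac _ \<sigma>0 z_ac, where a = 1 and b = 0, folded *, simplified]
    have rev_dims: "dim_row (rev_mat_poly g R) = dim_row R" "dim_col (rev_mat_poly g R) = dim_col R"
      for g and R :: "'a poly mat" by (simp_all add: rev_mat_poly_def)
    show ?thesis
      using core ev P(1) z
      unfolding right_eigenvector_inf_def right_eigenvector_def eval_ac_rev_mat_poly_0 rev_dims dims P_coeff
      by (subst (1 2 3) map_vec_block[OF z[unfolded nd']]) auto
  qed
  ultimately show ?thesis by blast
qed

end
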